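(* Let $H$ be a real Hilbert space, let $f:H\to(-\infty,+\infty]$ be a proper lower semi-continuous convex function, let $F:H\to H$ be a $\beta$-cocoercive operator with $\beta>0$, let $\gamma\in(0,2\beta)$, and let $(\lambda_t)_{t\in\mathbb{N}}$ be a sequence of real numbers with $\sigma_0:=\inf_{t\in\mathbb{N}}\{\lambda_t(1-\lambda_t)\}\in(0,1)$. Suppose $\operatorname{Sol}(\mathrm{VIP}(F,f))\ne\emptyset$. Let $x^0\in H$ and set $$x^{t+1}=(1-\lambda_t)\,x^t+\lambda_t R_{\gamma\partial f}(x^t-\gamma F(x^t))\qquad\forall t\in\mathbb{N}.$$ If $T_2:=R_{\gamma\partial f}\circ(I-\gamma F)$ is bounded Hölder regular, then $x^t\to\bar x$ in norm for some $\bar x\in\operatorname{Sol}(\mathrm{VIP}(F,f))$ at least with a sublinear rate $O(t^{-\rho})$ for some $\rho>0$. In particular, if $T_2$ is bounded Hölder regular with uniform exponent $\tau\in(0,1]$, then there exist $M>0$ and $r\in[0,1)$ such that, for all $t\ge1$, $$\|x^t-\bar x\|\le\begin{cases}M\,t^{-\frac{\tau}{2(1-\tau)}},&\tau\in(0,1),\\ M\,r^t,&\tau=1.\end{cases}$$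
   Context: $\mathbb{N}=\{0,1,2,\dots\}$; $\operatorname{Fix}T=\{x\in H: T(x)=x\}$; $d(x,A)=\inf_{a\in A}\|x-a\|$; $I$ is the identity. $F:H\to H$ is $\beta$-cocoercive if $\langle F(x)-F(y),x-y\rangle\ge\beta\|F(x)-F(y)\|^2$ for all $x,y\in H$. $\partial f$ is the convex subdifferential of $f$, and $R_{\gamma\partial f}:=(I+\gamma\partial f)^{-1}$ is the (single-valued, everywhere defined) resolvent of $\gamma\partial f$. The generalized variational inequality problem $\mathrm{VIP}(F,f)$ is: find $x^*\in H$ (necessarily with $f(x^* )<+\infty$) such that $f(x)-f(x^* )+\langle F(x^* ),x-x^*\rangle\ge0$ for all $x\in H$. Its set of solutions is $\operatorname{Sol}(\mathrm{VIP}(F,f))$. An operator $T:H\to H$ is bounded Hölder regular if for each bounded set $K\subseteq H$ there exist $\tau\in(0,1]$ and $\mu>0$ such that $d(x,\operatorname{Fix}T)\le\mu\|x-T(x)\|^\tau$ for all $x\in K$. If the exponent $\tau$ can be chosen independently of $K$, $T$ is bounded Hölder regular with uniform exponent $\tau$. Convergence with rate $O(t^{-\rho})$ means $\|x^t-\bar x\|\le Mt^{-\rho}$ for all $t\ge1$ and some constant $M$. *)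

theory Defs
  imports "HOL-Analysis.Analysis"
begin

definition proper :: "('a \<Rightarrow> ereal) \<Rightarrow> bool" where
  "proper f \<longleftrightarrow> (\<forall>x. f x \<noteq> -\<infinity>) \<and> (\<exists>x. f x \<noteq> \<infinity>)"

definition lower_semicontinuous :: "('a::topological_space \<Rightarrow> ereal) \<Rightarrow> bool" where
  "lower_semicontinuous f \<longleftrightarrow> (\<forall>x. f x \<le> Liminf (at x) f)"

text \<open>The following two definitions are only meant for functions that avoid \<open>-\<infinity>\<close>:
  on \<^typ>\<open>ereal\<close>, \<open>\<infinity> + (-\<infinity>) = \<infinity>\<close>.\<close>

definition convex_ereal :: "('a::real_vector \<Rightarrow> ereal) \<Rightarrow> bool" where
  "convex_ereal f \<longleftrightarrow>
     (\<forall>x y. \<forall>u\<in>{0<..<1}. f ((1 - u) *\<^sub>R x + u *\<^sub>R y) \<le> ereal (1 - u) * f x + ereal u * f y)"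

text \<open>For proper \<open>f\<close> the set below is empty wherever \<open>f x = \<infinity>\<close>, as in the usual convention.\<close>

definition subdifferential :: "('a::real_inner \<Rightarrow> ereal) \<Rightarrow> 'a \<Rightarrow> 'a set" where
  "subdifferential f x = {u. \<forall>y. f x + ereal (u \<bullet> (y - x)) \<le> f y}"

definition scale_op :: "real \<Rightarrow> ('a::real_vector \<Rightarrow> 'a set) \<Rightarrow> 'a \<Rightarrow> 'a set" where
  "scale_op \<gamma> A x = (\<lambda>u. \<gamma> *\<^sub>R u) ` A x"

text \<open>The inverse of the set-valued operator \<open>I + A\<close>, read as a function; meaningful when that
  inverse is single-valued and everywhere defined, e.g. for maximally monotone \<open>A\<close>.\<close>

definition resolvent :: "('a::real_vector \<Rightarrow> 'a set) \<Rightarrow> 'a \<Rightarrow> 'a" where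
  "resolvent A x = (THE p. x \<in> {p + u | u. u \<in> A p})"

definition cocoercive :: "real \<Rightarrow> ('a::real_inner \<Rightarrow> 'a) \<Rightarrow> bool" where
  "cocoercive \<beta> F \<longleftrightarrow> (\<forall>x y. (F x - F y) \<bullet> (x - y) \<ge> \<beta> * (norm (F x - F y))\<^sup>2)"

definition Sol_VIP :: "('a::real_inner \<Rightarrow> 'a) \<Rightarrow> ('a \<Rightarrow> ereal) \<Rightarrow> 'a set" where
  "Sol_VIP F f = {z. f z < \<infinity> \<and> (\<forall>x. f x - f z + ereal (F z \<bullet> (x - z)) \<ge> 0)}"

definition Fix :: "('a \<Rightarrow> 'a) \<Rightarrow> 'a set" where
  "Fix T = {x. T x = x}"

text \<open>Since \<^term>\<open>infdist x {} = 0\<close> (and not \<open>\<infinity>\<close>), the inequality below has its intended meaning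
  only for operators with a fixed point.\<close>

definition hoelder_regular_on :: "'a::real_normed_vector set \<Rightarrow> real \<Rightarrow> ('a \<Rightarrow> 'a) \<Rightarrow> bool" where
  "hoelder_regular_on K \<tau> T \<longleftrightarrow>
     (\<exists>\<mu>>0. \<forall>x\<in>K. infdist x (Fix T) \<le> \<mu> * norm (x - T x) powr \<tau>)"

definition bounded_hoelder_regular :: "('a::real_normed_vector \<Rightarrow> 'a) \<Rightarrow> bool" where
  "bounded_hoelder_regular T \<longleftrightarrow> (\<forall>K. bounded K \<longrightarrow> (\<exists>\<tau>\<in>{0<..1}. hoelder_regular_on K \<tau> T))"

definition bounded_hoelder_regular_uniform :: "real \<Rightarrow> ('a::real_normed_vector \<Rightarrow> 'a) \<Rightarrow> bool" where
  "bounded_hoelder_regular_uniform \<tau> T \<longleftrightarrow>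
     \<tau> \<in> {0<..1} \<and> (\<forall>K. bounded K \<longrightarrow> hoelder_regular_on K \<tau> T)"

definition sublinear_rate :: "(nat \<Rightarrow> 'a::real_normed_vector) \<Rightarrow> 'a \<Rightarrow> real \<Rightarrow> bool" where
  "sublinear_rate x z \<rho> \<longleftrightarrow> (\<exists>M. \<forall>t\<ge>1. norm (x t - z) \<le> M * real t powr (- \<rho>))"

end

theory Submission
  imports Defs
begin

text \<open>
  Any solution \<open>z\<close> of the variational inequality satisfies \<open>- F z \<in> \<partial>f(z)\<close>; this affine minorant
  bounds the proximal objective from below, so that minimising sequences are Cauchy by strong
  convexity and the resolvent of \<open>\<gamma>\<partial>f\<close> is everywhere defined. Hence \<open>T2\<close> is a nonexpansive map with
  \<open>Fix T2 = Sol_VIP F f\<close>, and along the Krasnoselskii-Mann iteration the distance \<open>d\<close> to the fixed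
  points satisfies \<open>d(t+1)^2 \<le> d(t)^2 - \<sigma> |x(t) - T2 x(t)|^2\<close>. Hoelder regularity turns this into
  \<open>a(t+1) \<le> a(t) - c a(t)^(1/\<tau>)\<close> for \<open>a = d^2\<close>, which gives the rate of \<open>d\<close>; by Fejer
  monotonicity the iterates converge to some \<open>z\<close> with \<open>|x(t) - z| \<le> 2 d(t)\<close>.
\<close>

section \<open>Resolvents of subdifferentials\<close>

lemma subgradient_finite:
  assumes "proper f" "u \<in> subdifferential f p"
  shows "f p \<noteq> \<infinity>" "f p \<noteq> -\<infinity>"
proof -
  from assms(1) obtain x where x: "f x \<noteq> \<infinity>" by (auto simp: proper_def)
  have "f p + ereal (u \<bullet> (x - p)) \<le> f x"
    using assms(2) by (auto simp: subdifferential_def)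
  with x show "f p \<noteq> \<infinity>" by auto
  show "f p \<noteq> -\<infinity>" using assms(1) by (auto simp: proper_def)
qed

lemma subdifferential_monotone:
  assumes "proper f" "u \<in> subdifferential f p" "v \<in> subdifferential f q"
  shows "(u - v) \<bullet> (p - q) \<ge> 0"
proof -
  obtain a where a: "f p = ereal a"
    using subgradient_finite[OF assms(1,2)] by (cases "f p") auto
  obtain b where b: "f q = ereal b"
    using subgradient_finite[OF assms(1,3)] by (cases "f q") auto
  have "f p + ereal (u \<bullet> (q - p)) \<le> f q" "f q + ereal (v \<bullet> (p - q)) \<le> f p"
    using assms(2,3) by (auto simp: subdifferential_def)
  then have "a + u \<bullet> (q - p) \<le> b" "b + v \<bullet> (p - q) \<le> a"
    by (auto simp: a b)
  then show ?thesis by (simp add: inner_simps)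
qed

text \<open>Serves the limit passage in the direct method, where only upper bounds
  \<open>r n\<close> on the values \<open>f (X n)\<close> are known to converge. A number
  \<open>b\<close> strictly between \<open>L\<close> and \<open>f p\<close> would be exceeded by
  \<open>f\<close> near \<open>p\<close>, yet \<open>r n\<close> drops below
  \<open>b\<close>.\<close>

lemma lsc_seq_le:
  fixes p :: "'a::{first_countable_topology, t1_space}"
  assumes "lower_semicontinuous f" "X \<longlonglongrightarrow> p"
    and "\<And>n. f (X n) \<le> ereal (r n)" "r \<longlonglongrightarrow> L"
  shows "f p \<le> ereal L"
proof (rule ccontr)
  assume "\<not> f p \<le> ereal L"
  then obtain b where b: "ereal L < ereal b" "ereal b < f p"
    by (metis ereal_dense2 not_le)
  have "eventually (\<lambda>y. ereal b < f y) (at p)"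
    using assms(1) b(2) unfolding lower_semicontinuous_def le_Liminf_iff by blast
  \<comment> \<open>The \<open>Liminf\<close> ignores the point \<open>p\<close> itself; since
    \<open>b < f p\<close>, the punctured neighbourhood can be filled in, which matters because
    \<open>X n\<close> may equal \<open>p\<close>.\<close>
  then have "eventually (\<lambda>y. ereal b < f y) (nhds p)"
    using b(2) by (auto simp: eventually_at_filter elim!: eventually_mono)
  then have "eventually (\<lambda>n. ereal b < f (X n)) sequentially"
    using assms(2) by (auto simp: filterlim_iff)
  moreover have "eventually (\<lambda>n. r n < b) sequentially"
    using assms(4) b(1) order_tendstoD(2)[of r L sequentially b] by simp
  ultimately have "eventually (\<lambda>n. False) sequentially"
  proof eventually_elim
    case (elim n)
    have "ereal b < ereal (r n)" by (rule less_le_trans[OF elim(1) assms(3)])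
    with elim(2) show ?case by simp
  qed
  then show False by simp
qed

text \<open>Completeness does the work of weak compactness here: near-minimisers are close to each
  other by the parallelogram identity. The objective is compared only at points with real values
  \<open>a\<close> and \<open>b\<close>.\<close>

lemma proximal_minimizer_exists:
  fixes f :: "'a::{real_inner, complete_space} \<Rightarrow> ereal"
  assumes prop_f: "proper f" and lsc: "lower_semicontinuous f" and conv: "convex_ereal f"
    and sub: "w \<in> subdifferential f z" and \<gamma>: "\<gamma> > 0"
  shows "\<exists>p a. f p = ereal a \<and>
    (\<forall>q b. f q = ereal b \<longrightarrow>
       a + (norm (p - y))\<^sup>2 / (2 * \<gamma>) \<le> b + (norm (q - y))\<^sup>2 / (2 * \<gamma>))"
proof -
  define D where "D = {p. f p \<noteq> \<infinity>}"
  define r where "r p = real_of_ereal (f p)" for p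
  have fr: "f p = ereal (r p)" if "p \<in> D" for p
    using that prop_f by (cases "f p") (auto simp: D_def r_def proper_def)
  have zD: "z \<in> D" using subgradient_finite[OF prop_f sub] by (simp add: D_def)
  define g where "g p = r p + (norm (p - y))\<^sup>2 / (2 * \<gamma>)" for p
  \<comment> \<open>The minorant \<open>r z + w \<bullet> (p - z)\<close> plus the quadratic is
    smallest at \<open>p = y - \<gamma> *\<^sub>R w\<close>, and \<open>c\<close> is its value
    there; completing the square proves the bound.\<close>
  define c where "c = r z + w \<bullet> (y - z) - \<gamma> * (norm w)\<^sup>2 / 2"
  have gc: "g p \<ge> c" if "p \<in> D" for p
  proof -
    have "f z + ereal (w \<bullet> (p - z)) \<le> f p" using sub by (auto simp: subdifferential_def)
    then have 1: "r z + w \<bullet> (p - z) \<le> r p" using that zD by (simp add: fr)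
    have "0 \<le> (norm (p - y + \<gamma> *\<^sub>R w))\<^sup>2 / (2 * \<gamma>)" using \<gamma> by simp
    also have "\<dots> = (norm (p - y))\<^sup>2 / (2 * \<gamma>) + w \<bullet> (p - y) + \<gamma> * (norm w)\<^sup>2 / 2"
      using \<gamma> unfolding power2_norm_eq_inner
      by (simp add: inner_simps field_simps inner_commute power2_eq_square)
    finally show ?thesis using 1 by (simp add: g_def c_def inner_simps)
  qed
  define m where "m = Inf (g ` D)"
  have bdd: "bdd_below (g ` D)" using gc by (auto intro!: bdd_belowI)
  have m_le: "m \<le> g p" if "p \<in> D" for p
    unfolding m_def using bdd that by (auto intro: cInf_lower)
  have conv_comb: "p + u *\<^sub>R (q - p) \<in> D \<and> r (p + u *\<^sub>R (q - p)) \<le> (1 - u) * r p + u * r q"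
    if "p \<in> D" "q \<in> D" "0 < u" "u < 1" for p q u
  proof -
    have "f ((1 - u) *\<^sub>R p + u *\<^sub>R q) \<le> ereal (1 - u) * f p + ereal u * f q"
      using conv that unfolding convex_ereal_def by auto
    also have "(1 - u) *\<^sub>R p + u *\<^sub>R q = p + u *\<^sub>R (q - p)" by (simp add: algebra_simps)
    finally have *: "f (p + u *\<^sub>R (q - p)) \<le> ereal ((1 - u) * r p + u * r q)"
      using that by (simp add: fr)
    then have "p + u *\<^sub>R (q - p) \<in> D" by (auto simp: D_def)
    with * show ?thesis by (simp add: fr)
  qed
  \<comment> \<open>At the midpoint the quadratic gains
    \<open>(norm (p - q))\<^sup>2 / (8 * \<gamma>)\<close> over the average, while \<open>g\<close>
    cannot fall below \<open>m\<close>. So the excesses of \<open>g p\<close> and \<open>g q\<close>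
    over \<open>m\<close> control the distance.\<close>
  have midpoint: "(norm (p - q))\<^sup>2 \<le> 4 * \<gamma> * (g p + g q - 2 * m)" if "p \<in> D" "q \<in> D" for p q
  proof -
    let ?h = "p + (1/2) *\<^sub>R (q - p)"
    have h: "?h \<in> D" "r ?h \<le> (1 - 1/2) * r p + (1/2) * r q"
      using conv_comb[OF that, of "1/2"] by auto
    have eq: "(norm (?h - y))\<^sup>2 = (norm (p - y))\<^sup>2 / 2 + (norm (q - y))\<^sup>2 / 2 - (norm (p - q))\<^sup>2 / 4"
      unfolding power2_norm_eq_inner by (simp add: inner_simps inner_commute field_simps)
    have "m \<le> g ?h" using m_le h by blast
    also have "\<dots> \<le> r p / 2 + r q / 2 + (norm (?h - y))\<^sup>2 / (2 * \<gamma>)"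
      unfolding g_def using h(2) by simp
    also have "\<dots> = (g p + g q) / 2 - (norm (p - q))\<^sup>2 / (8 * \<gamma>)"
      unfolding eq g_def using \<gamma> by (simp add: field_simps)
    finally show ?thesis using \<gamma> by (simp add: field_simps)
  qed
  have "\<exists>q\<in>D. g q < m + 1 / real (Suc n)" for n
  proof -
    have "Inf (g ` D) < m + 1 / real (Suc n)" by (simp add: m_def)
    then show ?thesis using cInf_lessD[of "g ` D"] zD by blast
  qed
  then obtain X where XD: "\<And>n. X n \<in> D" and Xm: "\<And>n. g (X n) < m + 1 / real (Suc n)" by metis
  have "Cauchy X"
  proof (rule metric_CauchyI)
    fix e :: real assume e: "e > 0"
    \<comment> \<open>Two excesses of this size, multiplied by the factor 4 \<gamma> of
      \<open>midpoint\<close>, add up to exactly \<open>e\<^sup>2\<close>.\<close>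
    have "e\<^sup>2 / (8 * \<gamma>) > 0" using e \<gamma> by simp
    then obtain N where N: "inverse (real (Suc N)) < e\<^sup>2 / (8 * \<gamma>)"
      using reals_Archimedean by blast
    show "\<exists>M. \<forall>i\<ge>M. \<forall>j\<ge>M. dist (X i) (X j) < e"
    proof (intro exI[of _ N] allI impI)
      fix i j assume ij: "N \<le> i" "N \<le> j"
      have small: "g (X k) < m + e\<^sup>2 / (8 * \<gamma>)" if "N \<le> k" for k
      proof -
        have "1 / real (Suc k) \<le> inverse (real (Suc N))" using that by (simp add: field_simps)
        then show ?thesis using Xm[of k] N by linarith
      qed
      have "(norm (X i - X j))\<^sup>2 \<le> 4 * \<gamma> * (g (X i) + g (X j) - 2 * m)"
        by (rule midpoint[OF XD XD])
      also have "\<dots> < 4 * \<gamma> * (e\<^sup>2 / (8 * \<gamma>) + e\<^sup>2 / (8 * \<gamma>))"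
        using small[OF ij(1)] small[OF ij(2)] \<gamma> by (intro mult_strict_left_mono) auto
      also have "\<dots> = e\<^sup>2" using \<gamma> by (simp add: field_simps)
      finally show "dist (X i) (X j) < e"
        using e by (simp add: dist_norm power2_less_imp_less)
    qed
  qed
  then obtain p where Xp: "X \<longlonglongrightarrow> p" using Cauchy_convergent convergent_def by blast
  \<comment> \<open>\<open>L\<close> is the limit of the bounds on \<open>f (X n)\<close> left after
    subtracting the quadratic from \<open>g (X n)\<close>; hence \<open>f p \<le> L\<close> says
    that \<open>g p \<le> m\<close>.\<close>
  define L where "L = m - (norm (p - y))\<^sup>2 / (2 * \<gamma>)"
  have "f p \<le> ereal L"
  proof (rule lsc_seq_le[OF lsc Xp])
    show "f (X n) \<le> ereal (m + 1 / real (Suc n) - (norm (X n - y))\<^sup>2 / (2 * \<gamma>))" for n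
      using Xm[of n] XD[of n] by (simp add: fr g_def)
    have "(\<lambda>n. m + 1 / real (Suc n) - (norm (X n - y))\<^sup>2 / (2 * \<gamma>)) \<longlonglongrightarrow> m + 0 - (norm (p - y))\<^sup>2 / (2 * \<gamma>)"
      using \<gamma> LIMSEQ_inverse_real_of_nat
      by (intro tendsto_intros Xp) (auto simp: inverse_eq_divide)
    then show "(\<lambda>n. m + 1 / real (Suc n) - (norm (X n - y))\<^sup>2 / (2 * \<gamma>)) \<longlonglongrightarrow> L"
      by (simp add: L_def)
  qed
  moreover from this have pD: "p \<in> D" by (auto simp: D_def)
  ultimately have "r p \<le> L" by (simp add: fr)
  then have gp: "g p \<le> m" by (simp add: g_def L_def)
  show ?thesis
  proof (intro exI conjI allI impI)
    show "f p = ereal (r p)" using pD by (rule fr)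
    fix q b assume q: "f q = ereal b"
    then have "q \<in> D" "r q = b" by (auto simp: D_def r_def)
    then show "r p + (norm (p - y))\<^sup>2 / (2 * \<gamma>) \<le> b + (norm (q - y))\<^sup>2 / (2 * \<gamma>)"
      using m_le[of q] gp by (simp add: g_def)
  qed
qed

text \<open>Fermat's rule for \<open>f\<close> plus a quadratic, done by hand: compare
  \<open>p\<close> with points on the segment towards \<open>x\<close> and let them approach
  \<open>p\<close>.\<close>

lemma proximal_minimizer_subgradient:
  fixes f :: "'a::real_inner \<Rightarrow> ereal"
  assumes prop_f: "proper f" and conv: "convex_ereal f" and \<gamma>: "\<gamma> > 0" and fp: "f p = ereal a"
    and min: "\<And>q b. f q = ereal b \<Longrightarrow>
       a + (norm (p - y))\<^sup>2 / (2 * \<gamma>) \<le> b + (norm (q - y))\<^sup>2 / (2 * \<gamma>)"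
  shows "(1 / \<gamma>) *\<^sub>R (y - p) \<in> subdifferential f p"
  unfolding subdifferential_def
proof (intro CollectI allI)
  fix x
  show "f p + ereal (((1 / \<gamma>) *\<^sub>R (y - p)) \<bullet> (x - p)) \<le> f x"
  proof (cases "f x = \<infinity>")
    case False
    then obtain b where b: "f x = ereal b" using prop_f by (cases "f x") (auto simp: proper_def)
    \<comment> \<open>\<open>k\<close> is the slack of the desired subgradient inequality and
      \<open>e\<close> the coefficient of the second-order term. Minimality gives
      \<open>0 \<le> u * (k + u * e)\<close>; divide by \<open>u\<close> and let it tend to 0 from
      the right.\<close>
    define k where "k = b - a - ((1 / \<gamma>) *\<^sub>R (y - p)) \<bullet> (x - p)"
    define e where "e = (norm (x - p))\<^sup>2 / (2 * \<gamma>)"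
    have k_ge: "0 \<le> k + u * e" if u: "0 < u" "u < 1" for u
    proof -
      define q where "q = (1 - u) *\<^sub>R p + u *\<^sub>R x"
      have "f q \<le> ereal (1 - u) * f p + ereal u * f x"
        using conv u unfolding convex_ereal_def q_def by auto
      then have q: "f q \<le> ereal ((1 - u) * a + u * b)" by (simp add: b fp)
      then obtain s where s: "f q = ereal s" "s \<le> (1 - u) * a + u * b"
        using prop_f by (cases "f q") (auto simp: proper_def)
      have "a + (norm (p - y))\<^sup>2 / (2 * \<gamma>) \<le> (1 - u) * a + u * b + (norm (q - y))\<^sup>2 / (2 * \<gamma>)"
        using min[OF s(1)] s(2) by linarith
      moreover have "q - y = (p - y) + u *\<^sub>R (x - p)" by (simp add: q_def algebra_simps)
      moreover have "(norm ((p - y) + u *\<^sub>R (x - p)))\<^sup>2 / (2 * \<gamma>)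
          = (norm (p - y))\<^sup>2 / (2 * \<gamma>) - u * (((1 / \<gamma>) *\<^sub>R (y - p)) \<bullet> (x - p)) + u * (u * e)"
        using \<gamma> unfolding power2_norm_eq_inner e_def
        by (simp add: inner_simps inner_commute field_simps)
      ultimately have "0 \<le> u * (k + u * e)"
        by (simp add: k_def algebra_simps)
      then show ?thesis using u by (simp add: zero_le_mult_iff)
    qed
    have "((\<lambda>u. k + u * e) \<longlongrightarrow> k + 0 * e) (at_right 0)"
      by (intro tendsto_intros)
    moreover have "eventually (\<lambda>u. 0 \<le> k + u * e) (at_right (0::real))"
      unfolding eventually_at_right_field using k_ge by (intro exI[of _ 1]) auto
    ultimately have "0 \<le> k + 0 * e"
      by (intro tendsto_lowerbound) auto
    then show ?thesis by (simp add: fp b k_def)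
  qed auto
qed

text \<open>Uniqueness for the \<open>THE\<close> comes from monotonicity: two decompositions
  \<open>p + \<gamma> *\<^sub>R u = q + \<gamma> *\<^sub>R v\<close> make the squared norm of
  \<open>q - p\<close> equal to \<gamma> times a nonpositive inner product.\<close>

lemma resolvent_eqI:
  assumes "proper f" "\<gamma> > 0" "u \<in> subdifferential f p" "y = p + \<gamma> *\<^sub>R u"
  shows "resolvent (scale_op \<gamma> (subdifferential f)) y = p"
  unfolding resolvent_def
proof (rule the_equality)
  show "y \<in> {p + u |u. u \<in> scale_op \<gamma> (subdifferential f) p}"
    using assms by (auto simp: scale_op_def)
  fix q assume "y \<in> {q + u |u. u \<in> scale_op \<gamma> (subdifferential f) q}"
  then obtain v where v: "v \<in> subdifferential f q" "y = q + \<gamma> *\<^sub>R v"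
    by (auto simp: scale_op_def)
  have eq: "q - p = \<gamma> *\<^sub>R (u - v)" using v(2) assms(4) by (simp add: algebra_simps)
  have "0 \<le> (u - v) \<bullet> (p - q)" using subdifferential_monotone assms v by blast
  then have "0 \<le> \<gamma> * ((u - v) \<bullet> (p - q))" using assms(2) by simp
  also have "\<dots> = (\<gamma> *\<^sub>R (u - v)) \<bullet> (p - q)" by simp
  also have "\<dots> = - ((q - p) \<bullet> (q - p))" unfolding eq[symmetric] by (simp add: inner_simps)
  finally have "(q - p) \<bullet> (q - p) \<le> 0" by simp
  then show "q = p" by (metis eq_iff_diff_eq_0 inner_eq_zero_iff inner_ge_zero order_antisym)
qed

text \<open>The proximal point is the value of the resolvent. From here on the resolvent is handled
  only through this inclusion and \<open>resolvent_eqI\<close>.\<close>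

lemma resolvent_subgradient:
  fixes f :: "'a::{real_inner, complete_space} \<Rightarrow> ereal"
  assumes "proper f" "lower_semicontinuous f" "convex_ereal f"
    and "w \<in> subdifferential f z" "\<gamma> > 0"
  shows "\<exists>u \<in> subdifferential f (resolvent (scale_op \<gamma> (subdifferential f)) y).
           y = resolvent (scale_op \<gamma> (subdifferential f)) y + \<gamma> *\<^sub>R u"
proof -
  obtain p a where pa: "f p = ereal a" "\<And>q b. f q = ereal b \<Longrightarrow>
       a + (norm (p - y))\<^sup>2 / (2 * \<gamma>) \<le> b + (norm (q - y))\<^sup>2 / (2 * \<gamma>)"
    using proximal_minimizer_exists[OF assms] by metis
  then have 1: "(1 / \<gamma>) *\<^sub>R (y - p) \<in> subdifferential f p"
    using proximal_minimizer_subgradient assms by blast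
  have 2: "y = p + \<gamma> *\<^sub>R ((1 / \<gamma>) *\<^sub>R (y - p))" using assms(5) by simp
  show ?thesis unfolding resolvent_eqI[OF assms(1,5) 1 2] using 1 2 by blast
qed

text \<open>Pairing \<open>x - y\<close> with \<open>J x - J y\<close> and dropping the monotone
  term gives firm nonexpansiveness; Cauchy-Schwarz then weakens it.\<close>

lemma resolvent_nonexpansive:
  fixes f :: "'a::{real_inner, complete_space} \<Rightarrow> ereal"
  assumes "proper f" "lower_semicontinuous f" "convex_ereal f"
    and "w \<in> subdifferential f z" "\<gamma> > 0"
  defines "J \<equiv> resolvent (scale_op \<gamma> (subdifferential f))"
  shows "norm (J x - J y) \<le> norm (x - y)"
proof -
  obtain u where u: "u \<in> subdifferential f (J x)" "x = J x + \<gamma> *\<^sub>R u"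
    using resolvent_subgradient[OF assms(1-5)] unfolding J_def by blast
  obtain v where v: "v \<in> subdifferential f (J y)" "y = J y + \<gamma> *\<^sub>R v"
    using resolvent_subgradient[OF assms(1-5)] unfolding J_def by blast
  have eq: "x - y = (J x - J y) + \<gamma> *\<^sub>R (u - v)"
    by (subst u(2), subst v(2)) (simp add: algebra_simps)
  have "0 \<le> (u - v) \<bullet> (J x - J y)" using subdifferential_monotone assms u v by blast
  then have "0 \<le> \<gamma> * ((u - v) \<bullet> (J x - J y))" using assms(5) by simp
  then have "(norm (J x - J y))\<^sup>2 \<le> (x - y) \<bullet> (J x - J y)"
    unfolding eq power2_norm_eq_inner by (simp add: inner_left_distrib)
  also have "\<dots> \<le> norm (x - y) * norm (J x - J y)" by (rule norm_cauchy_schwarz)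
  finally show ?thesis by (cases "J x = J y") (auto simp: power2_eq_square)
qed

section \<open>The forward-backward operator\<close>

text \<open>In the expanded square, cocoercivity makes the cross term at least 2 \<gamma> \<beta>
  times the squared norm of \<open>F x - F y\<close>, which absorbs the quadratic term because
  \<gamma> \<le> 2 \<beta>.\<close>

lemma cocoercive_forward_nonexpansive:
  assumes "cocoercive \<beta> F" "\<gamma> \<ge> 0" "\<gamma> \<le> 2 * \<beta>"
  shows "norm ((x - \<gamma> *\<^sub>R F x) - (y - \<gamma> *\<^sub>R F y)) \<le> norm (x - y)"
proof -
  let ?d = "F x - F y"
  have "\<beta> * (norm ?d)\<^sup>2 \<le> ?d \<bullet> (x - y)" using assms(1) by (auto simp: cocoercive_def)
  then have 1: "2 * \<gamma> * (\<beta> * (norm ?d)\<^sup>2) \<le> 2 * \<gamma> * (?d \<bullet> (x - y))"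
    using assms(2) by (intro mult_left_mono) auto
  have "\<gamma> * (norm ?d)\<^sup>2 * \<gamma> \<le> \<gamma> * (norm ?d)\<^sup>2 * (2 * \<beta>)"
    using assms(2,3) by (intro mult_left_mono) auto
  also have "\<dots> = 2 * \<gamma> * (\<beta> * (norm ?d)\<^sup>2)" by simp
  finally have "\<gamma> * (norm ?d)\<^sup>2 * \<gamma> \<le> 2 * \<gamma> * (\<beta> * (norm ?d)\<^sup>2)" .
  moreover have "(norm ((x - \<gamma> *\<^sub>R F x) - (y - \<gamma> *\<^sub>R F y)))\<^sup>2
      = (norm ((x - y) - \<gamma> *\<^sub>R ?d))\<^sup>2" by (simp add: algebra_simps)
  moreover have "\<dots> = (norm (x - y))\<^sup>2 - 2 * \<gamma> * (?d \<bullet> (x - y)) + \<gamma> * (norm ?d)\<^sup>2 * \<gamma>"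
    unfolding power2_norm_eq_inner by (simp add: inner_simps inner_commute algebra_simps)
  ultimately have "(norm ((x - \<gamma> *\<^sub>R F x) - (y - \<gamma> *\<^sub>R F y)))\<^sup>2 \<le> (norm (x - y))\<^sup>2"
    using 1 by linarith
  then show ?thesis by (rule power2_le_imp_le) simp
qed

text \<open>Either side forces \<open>f z\<close> to be finite, so the \<open>ereal\<close>
  inequality may be rearranged, also where \<open>f x\<close> is infinite.\<close>

lemma Sol_VIP_iff_subgradient:
  assumes "proper f"
  shows "z \<in> Sol_VIP F f \<longleftrightarrow> - F z \<in> subdifferential f z"
proof -
  have key: "0 \<le> f x - f z + ereal (F z \<bullet> (x - z)) \<longleftrightarrow> f z + ereal ((- F z) \<bullet> (x - z)) \<le> f x"
    if "f z \<noteq> \<infinity>" for x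
    using that assms by (cases "f x"; cases "f z") (auto simp: proper_def)
  show ?thesis
    using key subgradient_finite[OF assms, of "- F z" z]
    unfolding Sol_VIP_def subdifferential_def by fastforce
qed

text \<open>A fixed point \<open>x\<close> satisfies
  \<open>x - \<gamma> *\<^sub>R F x = x + \<gamma> *\<^sub>R u\<close> with a subgradient
  \<open>u\<close> at \<open>x\<close>; cancelling leaves \<open>u = - F x\<close>.\<close>

lemma Fix_forward_backward:
  fixes f :: "'a::{real_inner, complete_space} \<Rightarrow> ereal"
  assumes "proper f" "lower_semicontinuous f" "convex_ereal f"
    and "w \<in> subdifferential f z" "\<gamma> > 0"
  shows "Fix (resolvent (scale_op \<gamma> (subdifferential f)) \<circ> (\<lambda>y. y - \<gamma> *\<^sub>R F y)) = Sol_VIP F f"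
proof (intro set_eqI iffI)
  fix x assume "x \<in> Fix (resolvent (scale_op \<gamma> (subdifferential f)) \<circ> (\<lambda>y. y - \<gamma> *\<^sub>R F y))"
  then have "resolvent (scale_op \<gamma> (subdifferential f)) (x - \<gamma> *\<^sub>R F x) = x"
    by (simp add: Fix_def)
  then obtain u where u: "u \<in> subdifferential f x" "x - \<gamma> *\<^sub>R F x = x + \<gamma> *\<^sub>R u"
    using resolvent_subgradient[OF assms, of "x - \<gamma> *\<^sub>R F x"] by auto
  from u(2) have "\<gamma> *\<^sub>R (u + F x) = 0" by (simp add: algebra_simps)
  then have "u = - F x" using assms(5) by (simp add: eq_neg_iff_add_eq_0)
  with u(1) show "x \<in> Sol_VIP F f" by (simp add: Sol_VIP_iff_subgradient assms(1))
next
  fix x assume "x \<in> Sol_VIP F f"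
  then have "- F x \<in> subdifferential f x" by (simp add: Sol_VIP_iff_subgradient assms(1))
  then show "x \<in> Fix (resolvent (scale_op \<gamma> (subdifferential f)) \<circ> (\<lambda>y. y - \<gamma> *\<^sub>R F y))"
    using resolvent_eqI[OF assms(1,5), of "- F x" x "x - \<gamma> *\<^sub>R F x"] by (simp add: Fix_def)
qed

section \<open>Krasnoselskii-Mann iterations and Fejer monotonicity\<close>

lemma norm_convex_combination_sq:
  fixes a b :: "'a::real_inner"
  shows "(norm ((1 - l) *\<^sub>R a + l *\<^sub>R b))\<^sup>2
    = (1 - l) * (norm a)\<^sup>2 + l * (norm b)\<^sup>2 - l * (1 - l) * (norm (a - b))\<^sup>2"
  unfolding power2_norm_eq_inner by (simp add: inner_simps inner_commute algebra_simps)

lemma krasnoselskii_mann_step: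
  fixes T :: "'a::real_inner \<Rightarrow> 'a"
  assumes "norm (T x - T z) \<le> norm (x - z)" "z \<in> Fix T" "0 \<le> l"
  shows "(norm ((1 - l) *\<^sub>R x + l *\<^sub>R T x - z))\<^sup>2
    \<le> (norm (x - z))\<^sup>2 - l * (1 - l) * (norm (x - T x))\<^sup>2"
proof -
  have "(1 - l) *\<^sub>R x + l *\<^sub>R T x - z = (1 - l) *\<^sub>R (x - z) + l *\<^sub>R (T x - z)"
    by (simp add: algebra_simps)
  then have "(norm ((1 - l) *\<^sub>R x + l *\<^sub>R T x - z))\<^sup>2
      = (1 - l) * (norm (x - z))\<^sup>2 + l * (norm (T x - z))\<^sup>2 - l * (1 - l) * (norm (x - T x))\<^sup>2"
    by (simp add: norm_convex_combination_sq)
  moreover have "l * (norm (T x - z))\<^sup>2 \<le> l * (norm (x - z))\<^sup>2"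
    using assms by (intro mult_left_mono power_mono) (auto simp: Fix_def)
  ultimately show ?thesis by (simp add: algebra_simps)
qed

lemma infdist_greatest:
  assumes "A \<noteq> {}" "\<And>a. a \<in> A \<Longrightarrow> e \<le> dist x a"
  shows "e \<le> infdist x A"
  using assms by (auto simp: infdist_notempty intro: cINF_greatest)

text \<open>No nearest point of \<open>A\<close> has to be chosen: the hypothesis makes
  \<open>sqrt ((infdist y A)\<^sup>2 + e)\<close> a lower bound for every \<open>dist x a\<close>,
  hence for the infimum.\<close>

lemma infdist_sq_descent:
  assumes "A \<noteq> {}" and "\<And>a. a \<in> A \<Longrightarrow> (dist y a)\<^sup>2 \<le> (dist x a)\<^sup>2 - e" and "e \<ge> 0"
  shows "(infdist y A)\<^sup>2 \<le> (infdist x A)\<^sup>2 - e"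
proof -
  have "sqrt ((infdist y A)\<^sup>2 + e) \<le> infdist x A"
  proof (rule infdist_greatest[OF assms(1)])
    fix a assume a: "a \<in> A"
    have "(infdist y A)\<^sup>2 \<le> (dist y a)\<^sup>2"
      by (intro power_mono infdist_le[OF a] infdist_nonneg)
    then show "sqrt ((infdist y A)\<^sup>2 + e) \<le> dist x a"
      using assms(2)[OF a] by (intro real_le_lsqrt) auto
  qed
  then have "(infdist y A)\<^sup>2 + e \<le> (infdist x A)\<^sup>2" by (rule sqrt_le_D)
  then show ?thesis by simp
qed

text \<open>The factor 2 is the triangle inequality through \<open>a\<close>: both
  \<open>x s\<close> and \<open>x t\<close> lie within \<open>dist (x t) a\<close> of
  \<open>a\<close>. Then take the infimum over \<open>a\<close>.\<close>

lemma fejer_dist_le: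
  fixes x :: "nat \<Rightarrow> 'a::metric_space"
  assumes "A \<noteq> {}" and "\<And>a t. a \<in> A \<Longrightarrow> dist (x (Suc t)) a \<le> dist (x t) a" and "t \<le> s"
  shows "dist (x s) (x t) \<le> 2 * infdist (x t) A"
proof -
  have "dist (x s) (x t) / 2 \<le> infdist (x t) A"
  proof (rule infdist_greatest[OF assms(1)])
    fix a assume "a \<in> A"
    then have "dist (x s) a \<le> dist (x t) a"
      by (intro lift_Suc_antimono_le[OF _ assms(3), of "\<lambda>t. dist (x t) a"] assms(2))
    then show "dist (x s) (x t) / 2 \<le> dist (x t) a"
      using dist_triangle2[of "x s" "x t" a] by simp
  qed
  then show ?thesis by simp
qed

text \<open>\<open>fejer_dist_le\<close> is used twice: for the Cauchy property, and with
  \<open>s\<close> tending to infinity for the distance to the limit.\<close>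

lemma fejer_convergent:
  fixes x :: "nat \<Rightarrow> 'a::complete_space"
  assumes "A \<noteq> {}" "closed A" and fejer: "\<And>a t. a \<in> A \<Longrightarrow> dist (x (Suc t)) a \<le> dist (x t) a"
    and lim: "(\<lambda>t. infdist (x t) A) \<longlonglongrightarrow> 0"
  obtains z where "z \<in> A" "x \<longlonglongrightarrow> z" "\<And>t. dist (x t) z \<le> 2 * infdist (x t) A"
proof -
  note le = fejer_dist_le[of A x, OF assms(1) fejer]
  have "Cauchy x"
  proof (rule metric_CauchyI)
    fix e :: real assume e: "e > 0"
    have "eventually (\<lambda>t. infdist (x t) A < e / 4) sequentially"
      using order_tendstoD(2)[OF lim, of "e / 4"] e by simp
    then obtain N where N: "infdist (x N) A < e / 4" by (auto simp: eventually_sequentially)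
    show "\<exists>M. \<forall>i\<ge>M. \<forall>j\<ge>M. dist (x i) (x j) < e"
    proof (intro exI[of _ N] allI impI)
      fix i j assume "N \<le> i" "N \<le> j"
      then show "dist (x i) (x j) < e"
        using le[of N i] le[of N j] N dist_triangle2[of "x i" "x j" "x N"] by linarith
    qed
  qed
  then obtain z where z: "x \<longlonglongrightarrow> z" using Cauchy_convergent convergent_def by blast
  have "(\<lambda>t. infdist (x t) A) \<longlonglongrightarrow> infdist z A" by (intro tendsto_infdist z)
  then have "infdist z A = 0" using lim LIMSEQ_unique by blast
  then have "z \<in> A" using assms(1,2) in_closed_iff_infdist_zero by blast
  moreover have "dist (x t) z \<le> 2 * infdist (x t) A" for t
  proof -
    have "(\<lambda>s. dist (x s) (x t)) \<longlonglongrightarrow> dist z (x t)" by (intro tendsto_intros z)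
    then have "dist z (x t) \<le> 2 * infdist (x t) A"
      by (rule LIMSEQ_le_const2) (use le in blast)
    then show ?thesis by (simp add: dist_commute)
  qed
  ultimately show thesis using z that by blast
qed

lemma closed_Fix_nonexpansive:
  fixes T :: "'a::real_normed_vector \<Rightarrow> 'a"
  assumes "\<And>x y. norm (T x - T y) \<le> norm (x - y)"
  shows "closed (Fix T)"
proof -
  have "continuous_on UNIV T"
    unfolding continuous_on_iff dist_norm using assms by (meson le_less_trans)
  then show ?thesis unfolding Fix_def by (intro closed_Collect_eq) auto
qed

section \<open>Rates from the descent recurrence\<close>

text \<open>Discrete version of the differential equation a' = -c a^(1+s): the quantity
  \<open>a t powr (- s)\<close> grows by at least \<open>s * c\<close> per step.\<close>

lemma descent_power_rate:
  fixes a :: "nat \<Rightarrow> real"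
  assumes nonneg: "\<And>t. a t \<ge> 0" and s: "s > 0" and c: "c > 0"
    and desc: "\<And>t. a (Suc t) \<le> a t - c * a t powr (1 + s)"
    and t: "t \<ge> 1"
  shows "a t \<le> (s * c * real t) powr (- (1 / s))"
proof -
  \<comment> \<open>Positivity is demanded because \<open>0 powr (- s)\<close> is 0. It passes
    backwards from \<open>Suc t\<close> to \<open>t\<close>, since the sequence does not
    increase.\<close>
  have growth: "a t > 0 \<Longrightarrow> a t powr (- s) \<ge> s * c * real t" for t
  proof (induction t)
    case (Suc t)
    have "c * a t powr (1 + s) \<ge> 0" using c by simp
    then have pos: "a t > 0" using Suc.prems desc[of t] nonneg[of t] by linarith
    \<comment> \<open>\<open>u\<close> is the guaranteed relative decrease in this step; multiplying
      it by \<open>a t powr (- s)\<close> gives back \<open>c\<close>.\<close>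
    define u where "u = c * a t powr s"
    have le: "a (Suc t) \<le> a t * (1 - u)"
      using desc[of t] pos by (simp add: u_def powr_add algebra_simps)
    then have u1: "1 - u > 0" using Suc.prems pos by (smt (verit) mult_nonneg_nonpos)
    \<comment> \<open>Bernoulli's inequality for the negative exponent \<open>- s\<close>, obtained
      from the tangent bounds of \<open>exp\<close> and \<open>ln\<close>.\<close>
    have "1 + s * u \<le> exp (s * u)" by (rule exp_ge_add_one_self)
    also have "\<dots> \<le> exp (- s * ln (1 - u))"
      using mult_left_mono[OF ln_le_minus_one[OF u1], of s] s by simp
    also have "\<dots> = (1 - u) powr (- s)" using u1 by (simp add: powr_def)
    finally have bern: "1 + s * u \<le> (1 - u) powr (- s)" .
    have "s * c * real (Suc t) \<le> a t powr (- s) + s * c"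
      using Suc.IH[OF pos] by (simp add: algebra_simps)
    also have "\<dots> = a t powr (- s) * (1 + s * u)"
      using pos by (simp add: u_def powr_minus field_simps)
    also have "\<dots> \<le> a t powr (- s) * (1 - u) powr (- s)"
      using bern by (intro mult_left_mono) auto
    also have "\<dots> = (a t * (1 - u)) powr (- s)" using pos u1 by (simp add: powr_mult)
    also have "\<dots> \<le> a (Suc t) powr (- s)"
      using le Suc.prems s by (intro powr_mono2') auto
    finally show ?case .
  qed simp
  show ?thesis
  proof (cases "a t > 0")
    case True
    have "s * c * real t > 0" using s c t by simp
    then have "(a t powr (- s)) powr (- (1 / s)) \<le> (s * c * real t) powr (- (1 / s))"
      using growth[OF True] s by (intro powr_mono2') auto
    then show ?thesis using True s by (simp add: powr_powr)
  next
    case False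
    then have "a t = 0" using nonneg[of t] by simp
    then show ?thesis by simp
  qed
qed

lemma descent_linear_rate:
  fixes d :: "nat \<Rightarrow> real"
  assumes nonneg: "\<And>t. d t \<ge> 0" and c: "c > 0"
    and desc: "\<And>t. (d (Suc t))\<^sup>2 \<le> (d t)\<^sup>2 - c * (d t)\<^sup>2"
  obtains r where "0 \<le> r" "r < 1" "\<And>t. d t \<le> d 0 * r ^ t"
proof -
  \<comment> \<open>Capping \<open>c\<close> at 1 keeps the radicand nonnegative.\<close>
  define r where "r = sqrt (1 - min c 1)"
  have r: "0 \<le> r" "r < 1" "r\<^sup>2 = 1 - min c 1" using c by (auto simp: r_def)
  have step: "d (Suc t) \<le> r * d t" for t
  proof (rule power2_le_imp_le)
    have "min c 1 * (d t)\<^sup>2 \<le> c * (d t)\<^sup>2" by (intro mult_right_mono) auto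
    then show "(d (Suc t))\<^sup>2 \<le> (r * d t)\<^sup>2"
      using desc[of t] by (simp add: power_mult_distrib r(3) algebra_simps)
    show "0 \<le> r * d t" using r nonneg by simp
  qed
  have "d t \<le> d 0 * r ^ t" for t
  proof (induction t)
    case (Suc t)
    have "d (Suc t) \<le> r * d t" by (rule step)
    also have "\<dots> \<le> r * (d 0 * r ^ t)" using Suc r by (intro mult_left_mono) auto
    finally show ?case by (simp add: algebra_simps)
  qed simp
  then show thesis using that r by blast
qed

lemma hoelder_descent_rate:
  fixes d n :: "nat \<Rightarrow> real"
  assumes d: "\<And>t. d t \<ge> 0" and n: "\<And>t. n t \<ge> 0" and \<sigma>: "\<sigma> > 0" and \<mu>: "\<mu> > 0"
    and \<tau>: "0 < \<tau>" "\<tau> \<le> 1"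
    and desc: "\<And>t. (d (Suc t))\<^sup>2 \<le> (d t)\<^sup>2 - \<sigma> * (n t)\<^sup>2"
    and hoelder: "\<And>t. d t \<le> \<mu> * n t powr \<tau>"
  shows "\<exists>M>0. \<exists>r\<in>{0..<1}. \<forall>t\<ge>1.
    d t \<le> (if \<tau> < 1 then M * real t powr (- (\<tau> / (2 * (1 - \<tau>)))) else M * r ^ t)"
proof -
  \<comment> \<open>Solving the regularity bound for the residual gives \<open>((d t)\<^sup>2 /
    \<mu>\<^sup>2) powr (1 / \<tau>) \<le> (n t)\<^sup>2\<close>; the factor \<open>\<sigma>\<close>
    comes from the descent.\<close>
  define c where "c = \<sigma> * (1 / \<mu>\<^sup>2) powr (1 / \<tau>)"
  have c: "c > 0" using \<sigma> \<mu> by (simp add: c_def)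
  have desc': "(d (Suc t))\<^sup>2 \<le> (d t)\<^sup>2 - c * ((d t)\<^sup>2) powr (1 / \<tau>)" for t
  proof -
    have "(d t)\<^sup>2 \<le> (\<mu> * n t powr \<tau>)\<^sup>2" using hoelder d by (intro power_mono) auto
    then have "(1 / \<mu>\<^sup>2) * (d t)\<^sup>2 \<le> (n t powr \<tau>)\<^sup>2"
      using \<mu> by (simp add: power_mult_distrib field_simps)
    also have "\<dots> = ((n t)\<^sup>2) powr \<tau>"
      by (simp add: power2_eq_square powr_mult n)
    finally have "((1 / \<mu>\<^sup>2) * (d t)\<^sup>2) powr (1 / \<tau>) \<le> (((n t)\<^sup>2) powr \<tau>) powr (1 / \<tau>)"
      using \<tau> by (intro powr_mono2) auto
    also have "\<dots> = (n t)\<^sup>2" using \<tau> by (simp add: powr_powr)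
    also have "((1 / \<mu>\<^sup>2) * (d t)\<^sup>2) powr (1 / \<tau>) = (1 / \<mu>\<^sup>2) powr (1 / \<tau>) * ((d t)\<^sup>2) powr (1 / \<tau>)"
      by (rule powr_mult)
    finally have "c * ((d t)\<^sup>2) powr (1 / \<tau>) \<le> \<sigma> * (n t)\<^sup>2"
      using \<sigma> by (simp add: c_def mult.assoc)
    then show ?thesis using desc[of t] by linarith
  qed
  show ?thesis
  proof (cases "\<tau> < 1")
    case True
    \<comment> \<open>Chosen so that 1 + s = 1/\<tau>. The squared distance then decays with
      exponent 1/s, and the distance itself with half of that.\<close>
    define s where "s = (1 - \<tau>) / \<tau>"
    have s: "s > 0" "1 + s = 1 / \<tau>" using True \<tau> by (auto simp: s_def field_simps)
    define M where "M = (s * c) powr (- (\<tau> / (2 * (1 - \<tau>))))"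
    have "d t \<le> M * real t powr (- (\<tau> / (2 * (1 - \<tau>))))" if "t \<ge> 1" for t
    proof -
      have "(d t)\<^sup>2 \<le> (s * c * real t) powr (- (1 / s))"
        by (rule descent_power_rate[of "\<lambda>t. (d t)\<^sup>2"]) (use desc' s c that in auto)
      then have "((d t)\<^sup>2) powr (1 / 2) \<le> ((s * c * real t) powr (- (1 / s))) powr (1 / 2)"
        by (intro powr_mono2) auto
      also have "\<dots> = (s * c * real t) powr (- (\<tau> / (2 * (1 - \<tau>))))"
        using True \<tau> by (simp add: powr_powr s_def field_simps)
      also have "\<dots> = M * real t powr (- (\<tau> / (2 * (1 - \<tau>))))"
        using s c by (simp add: M_def powr_mult)
      also have "((d t)\<^sup>2) powr (1 / 2) = d t" using d[of t] by (simp add: powr_half_sqrt)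
      finally show ?thesis .
    qed
    moreover have "M > 0" using s c by (simp add: M_def)
    ultimately show ?thesis using True by (intro exI[of _ M] conjI bexI[of _ 0]) auto
  next
    case False
    then have "\<tau> = 1" using \<tau> by simp
    then have "(d (Suc t))\<^sup>2 \<le> (d t)\<^sup>2 - c * (d t)\<^sup>2" for t using desc'[of t] by simp
    then obtain r where r: "0 \<le> r" "r < 1" "\<And>t. d t \<le> d 0 * r ^ t"
      using descent_linear_rate[of d c] d c by blast
    \<comment> \<open>\<open>d 0\<close> may vanish, whereas the constant \<open>M\<close> must be
      positive.\<close>
    have "d t \<le> (d 0 + 1) * r ^ t" for t
    proof -
      have "d 0 * r ^ t \<le> (d 0 + 1) * r ^ t" using r by (intro mult_right_mono) auto
      then show ?thesis using r(3)[of t] by linarith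
    qed
    moreover have "d 0 + 1 > 0" using d[of 0] by simp
    ultimately show ?thesis using False r by (intro exI[of _ "d 0 + 1"] conjI bexI[of _ r]) auto
  qed
qed

lemma geometric_le_inverse:
  fixes r :: real
  assumes "0 \<le> r" "r < 1"
  shows "\<exists>B. \<forall>t\<ge>1. r ^ t \<le> B * real t powr (- 1)"
proof -
  have "(\<lambda>t. real t * r ^ t) \<longlonglongrightarrow> 0"
    using assms by (intro powser_times_n_limit_0) auto
  then have "Bseq (\<lambda>t. real t * r ^ t)" by (intro convergent_imp_Bseq) (auto simp: convergent_def)
  then obtain B where B: "\<And>t. norm (real t * r ^ t) \<le> B" by (auto simp: Bseq_def)
  have "r ^ t \<le> B * real t powr (- 1)" if "t \<ge> 1" for t
    using B[of t] that assms by (simp add: powr_minus field_simps)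
  then show ?thesis by blast
qed

text \<open>When \<tau> = 1 the geometric rate is traded for a power rate; the exponent 1 is an
  arbitrary choice.\<close>

lemma hoelder_rate_imp_sublinear:
  fixes \<tau> :: real
  assumes "0 < \<tau>" "M > 0" "0 \<le> r" "r < 1"
    and rate: "\<And>t. t \<ge> 1 \<Longrightarrow>
      d t \<le> (if \<tau> < 1 then M * real t powr (- (\<tau> / (2 * (1 - \<tau>)))) else M * r ^ t)"
  obtains \<rho> N where "\<rho> > 0" "\<And>t. t \<ge> 1 \<Longrightarrow> d t \<le> N * real t powr (- \<rho>)"
proof (cases "\<tau> < 1")
  case True
  show thesis
    by (rule that[of "\<tau> / (2 * (1 - \<tau>))" M]) (use True assms in auto)
next
  case False
  obtain B where B: "\<And>t. t \<ge> 1 \<Longrightarrow> r ^ t \<le> B * real t powr (- 1)"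
    using geometric_le_inverse assms by blast
  show thesis
  proof (rule that[of 1 "M * B"])
    fix t :: nat assume t: "t \<ge> 1"
    have "d t \<le> M * r ^ t" using rate[OF t] False by simp
    also have "\<dots> \<le> M * (B * real t powr (- 1))" using B[OF t] assms(2) by (intro mult_left_mono) auto
    finally show "d t \<le> M * B * real t powr (- 1)" by (simp add: mult.assoc)
  qed simp
qed

section \<open>Convergence and rates of the Krasnoselskii-Mann iteration\<close>

theorem krasnoselskii_mann_hoelder_rate:
  fixes T :: "'a::{real_inner, complete_space} \<Rightarrow> 'a"
  assumes nonexp: "\<And>x y. norm (T x - T y) \<le> norm (x - y)"
    and ne: "Fix T \<noteq> {}"
    and \<sigma>: "\<sigma> > 0" "\<And>t. lam t * (1 - lam t) \<ge> \<sigma>"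
    and iter: "\<And>t. x (Suc t) = (1 - lam t) *\<^sub>R x t + lam t *\<^sub>R T (x t)"
    and reg: "bounded_hoelder_regular T"
  shows "\<exists>z \<in> Fix T.
           x \<longlonglongrightarrow> z
         \<and> (\<exists>\<rho>>0. sublinear_rate x z \<rho>)
         \<and> (\<forall>\<tau>. bounded_hoelder_regular_uniform \<tau> T \<longrightarrow>
              (\<exists>M>0. \<exists>r\<in>{0..<1}. \<forall>t\<ge>1.
                 norm (x t - z) \<le> (if \<tau> < 1 then M * real t powr (- (\<tau> / (2 * (1 - \<tau>))))
                                   else M * r ^ t)))"
proof -
  define d where "d t = infdist (x t) (Fix T)" for t
  define n where "n t = norm (x t - T (x t))" for t
  have step: "(dist (x (Suc t)) a)\<^sup>2 \<le> (dist (x t) a)\<^sup>2 - \<sigma> * (n t)\<^sup>2" if "a \<in> Fix T" for a t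
  proof -
    \<comment> \<open>A positive product forces \<open>lam t\<close> into the open unit interval,
      which supplies the sign needed for the Krasnoselskii-Mann step.\<close>
    have "lam t * (1 - lam t) > 0" using \<sigma> by (metis less_le_trans)
    then have "lam t \<ge> 0" by (auto simp: zero_less_mult_iff)
    then have "(dist (x (Suc t)) a)\<^sup>2 \<le> (dist (x t) a)\<^sup>2 - lam t * (1 - lam t) * (n t)\<^sup>2"
      using krasnoselskii_mann_step[OF nonexp that] by (simp add: dist_norm iter n_def)
    moreover have "\<sigma> * (n t)\<^sup>2 \<le> lam t * (1 - lam t) * (n t)\<^sup>2"
      using \<sigma>(2) by (intro mult_right_mono) auto
    ultimately show ?thesis by linarith
  qed
  have fejer: "dist (x (Suc t)) a \<le> dist (x t) a" if "a \<in> Fix T" for a t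
  proof (rule power2_le_imp_le)
    have "0 \<le> \<sigma> * (n t)\<^sup>2" using \<sigma>(1) by simp
    then show "(dist (x (Suc t)) a)\<^sup>2 \<le> (dist (x t) a)\<^sup>2" using step[OF that, of t] by linarith
  qed simp
  have desc: "(d (Suc t))\<^sup>2 \<le> (d t)\<^sup>2 - \<sigma> * (n t)\<^sup>2" for t
    unfolding d_def using ne step \<sigma>(1) by (intro infdist_sq_descent) auto
  \<comment> \<open>Boundedness follows from Fejer monotonicity alone, so the regularity assumption
    can be applied to the set of all iterates.\<close>
  have bdd: "bounded (range x)"
    using fejer_dist_le[of "Fix T" x, OF ne fejer, of 0]
    unfolding bounded_any_center[of _ "x 0"] by (auto simp: dist_commute)
  have rate: "\<exists>M>0. \<exists>r\<in>{0..<1}. \<forall>t\<ge>1.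
      d t \<le> (if \<tau> < 1 then M * real t powr (- (\<tau> / (2 * (1 - \<tau>)))) else M * r ^ t)"
    if \<tau>: "\<tau> \<in> {0<..1}" and hr: "hoelder_regular_on (range x) \<tau> T" for \<tau>
  proof -
    from hr obtain \<mu> where \<mu>: "\<mu> > 0" "\<And>t. d t \<le> \<mu> * n t powr \<tau>"
      by (auto simp: hoelder_regular_on_def d_def n_def)
    show ?thesis
      by (rule hoelder_descent_rate[of d n \<sigma> \<mu> \<tau>])
        (use \<mu> \<tau> \<sigma> desc in \<open>auto simp: d_def n_def infdist_nonneg\<close>)
  qed
  \<comment> \<open>This exponent belongs to the range of \<open>x\<close>. It yields the limit
    \<open>z\<close> and some power rate; \<open>z\<close> is thus fixed before any uniform exponent
    is considered.\<close>
  obtain \<tau>0 where "\<tau>0 \<in> {0<..1}" "hoelder_regular_on (range x) \<tau>0 T"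
    using reg bdd by (auto simp: bounded_hoelder_regular_def)
  with rate[of \<tau>0] obtain M r where "M > 0" "0 \<le> r" "r < 1" "0 < \<tau>0"
    "\<And>t. t \<ge> 1 \<Longrightarrow>
      d t \<le> (if \<tau>0 < 1 then M * real t powr (- (\<tau>0 / (2 * (1 - \<tau>0)))) else M * r ^ t)"
    by auto
  then obtain \<rho> N where \<rho>: "\<rho> > 0" and N: "\<And>t. t \<ge> 1 \<Longrightarrow> d t \<le> N * real t powr (- \<rho>)"
    using hoelder_rate_imp_sublinear[of \<tau>0 M r d] by blast
  have "d \<longlonglongrightarrow> 0"
  proof (rule tendsto_sandwich[of "\<lambda>_. 0" _ _ "\<lambda>t. N * real t powr (- \<rho>)"])
    have "(\<lambda>t. N * real t powr (- \<rho>)) \<longlonglongrightarrow> N * 0"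
      using \<rho> by (intro tendsto_mult tendsto_const tendsto_neg_powr filterlim_real_sequentially) auto
    then show "(\<lambda>t. N * real t powr (- \<rho>)) \<longlonglongrightarrow> 0" by simp
    show "eventually (\<lambda>t. d t \<le> N * real t powr (- \<rho>)) sequentially"
      using N by (auto simp: eventually_sequentially)
  qed (auto simp: d_def infdist_nonneg)
  then obtain z where z: "z \<in> Fix T" "x \<longlonglongrightarrow> z" and le: "\<And>t. norm (x t - z) \<le> 2 * d t"
    using fejer_convergent[of "Fix T" x] ne closed_Fix_nonexpansive[of T] nonexp fejer
    unfolding d_def dist_norm by blast
  have "sublinear_rate x z \<rho>"
    unfolding sublinear_rate_def
  proof (intro exI allI impI)
    fix t :: nat assume "1 \<le> t"
    then show "norm (x t - z) \<le> 2 * N * real t powr (- \<rho>)" using le[of t] N[of t] by simp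
  qed
  moreover have "\<exists>M>0. \<exists>r\<in>{0..<1}. \<forall>t\<ge>1.
      norm (x t - z) \<le> (if \<tau> < 1 then M * real t powr (- (\<tau> / (2 * (1 - \<tau>)))) else M * r ^ t)"
    if "bounded_hoelder_regular_uniform \<tau> T" for \<tau>
  proof -
    have "\<tau> \<in> {0<..1}" "hoelder_regular_on (range x) \<tau> T"
      using that bdd by (auto simp: bounded_hoelder_regular_uniform_def)
    from rate[OF this] obtain M r where M: "M > 0" "r \<in> {0..<1}" and
      dM: "\<And>t. t \<ge> 1 \<Longrightarrow>
        d t \<le> (if \<tau> < 1 then M * real t powr (- (\<tau> / (2 * (1 - \<tau>)))) else M * r ^ t)"
      by blast
    show ?thesis
    proof (intro exI[of _ "2 * M"] conjI bexI[of _ r] allI impI)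
      fix t :: nat assume "1 \<le> t"
      then show "norm (x t - z) \<le>
          (if \<tau> < 1 then 2 * M * real t powr (- (\<tau> / (2 * (1 - \<tau>)))) else 2 * M * r ^ t)"
        using dM[of t] le[of t] by (auto split: if_splits)
    qed (use M in auto)
  qed
  ultimately show ?thesis using z \<rho> by blast
qed

theorem corollary3p11:
  fixes f :: "'a::{real_inner, complete_space} \<Rightarrow> ereal"
    and F :: "'a \<Rightarrow> 'a"
    and \<beta> \<gamma> :: real
    and lam :: "nat \<Rightarrow> real"
    and x :: "nat \<Rightarrow> 'a"
    and T2 :: "'a \<Rightarrow> 'a"
  assumes "proper f" and "lower_semicontinuous f" and "convex_ereal f"
    and "\<beta> > 0" and "cocoercive \<beta> F"
    and "\<gamma> \<in> {0<..<2 * \<beta>}"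
    and "(INF t. ereal (lam t * (1 - lam t))) \<in> {0<..<1}"
    and "Sol_VIP F f \<noteq> {}"
    and "\<And>t. x (Suc t) = (1 - lam t) *\<^sub>R x t
               + lam t *\<^sub>R resolvent (scale_op \<gamma> (subdifferential f)) (x t - \<gamma> *\<^sub>R F (x t))"
    and "T2 = resolvent (scale_op \<gamma> (subdifferential f)) \<circ> (\<lambda>y. y - \<gamma> *\<^sub>R F y)"
    and "bounded_hoelder_regular T2"
  shows "\<exists>z \<in> Sol_VIP F f.
           x \<longlonglongrightarrow> z
         \<and> (\<exists>\<rho>>0. sublinear_rate x z \<rho>)
         \<and> (\<forall>\<tau>. bounded_hoelder_regular_uniform \<tau> T2 \<longrightarrow>
              (\<exists>M>0. \<exists>r\<in>{0..<1}. \<forall>t\<ge>1.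
                 norm (x t - z) \<le> (if \<tau> < 1 then M * real t powr (- (\<tau> / (2 * (1 - \<tau>))))
                                   else M * r ^ t)))"
proof -
  \<comment> \<open>Solvability enters twice: \<open>z0\<close> provides the subgradient behind the
    existence of proximal points, and it makes \<open>Fix T2\<close> nonempty, so that
    \<open>infdist\<close> is a genuine distance.\<close>
  from assms(8) obtain z0 where "z0 \<in> Sol_VIP F f" by blast
  then have sub: "- F z0 \<in> subdifferential f z0" by (simp add: Sol_VIP_iff_subgradient assms(1))
  have \<gamma>: "\<gamma> > 0" "\<gamma> \<le> 2 * \<beta>" using assms(6) by auto
  have nonexp: "norm (T2 u - T2 v) \<le> norm (u - v)" for u v
    unfolding assms(10) comp_def
    by (rule order_trans[OF resolvent_nonexpansive[OF assms(1-3) sub \<gamma>(1)]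
          cocoercive_forward_nonexpansive[OF assms(5) less_imp_le[OF \<gamma>(1)] \<gamma>(2)]])
  have Fix: "Fix T2 = Sol_VIP F f"
    unfolding assms(10) by (rule Fix_forward_backward[OF assms(1-3) sub \<gamma>(1)])
  \<comment> \<open>The extended-real infimum lies strictly between 0 and 1, hence is a positive
    real number.\<close>
  obtain \<sigma> where \<sigma>: "(INF t. ereal (lam t * (1 - lam t))) = ereal \<sigma>" "\<sigma> > 0"
    using assms(7) by (cases "INF t. ereal (lam t * (1 - lam t))") auto
  have lam: "lam t * (1 - lam t) \<ge> \<sigma>" for t
    using INF_lower[of t UNIV "\<lambda>t. ereal (lam t * (1 - lam t))"] \<sigma>(1) by simp
  have iter: "x (Suc t) = (1 - lam t) *\<^sub>R x t + lam t *\<^sub>R T2 (x t)" for t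
    unfolding assms(10) comp_def by (rule assms(9))
  show ?thesis
    by (rule krasnoselskii_mann_hoelder_rate[of T2 \<sigma> lam x, unfolded Fix])
      (fact nonexp assms(8,11) \<sigma>(2) lam iter)+
qed

end
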